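(* Let $f \in P(\mathbb{R})$ and let $\Phi$ be a mean on $L^{\infty}(\mathbb{R})$. Then $\Phi$ is topologically invariant if and only if $$\Phi(\phi) \le \overline{F}_u(\phi)$$ for every $\phi \in L^{\infty}_R(\mathbb{R})$, where $\overline{F}_u(\phi) = \limsup_{r \to \infty} \sup_{x \in \mathbb{R}} (f_r * \phi)(x)$ and $f_r(x) = r^{-1} f(x/r)$ for $r>0$.
   Context: $L^{\infty}(\mathbb{R})$ is the space of (complex-valued) essentially bounded measurable functions on $\mathbb{R}$, and $L^{\infty}_R(\mathbb{R})$ is the subset of real-valued ones. $P(\mathbb{R})$ is the set of $f \in L^1(\mathbb{R})$ with $f \ge 0$ and $\int_{\mathbb{R}} f(x)\,dx = 1$. Convolution: $(f*\phi)(x) = \int_{\mathbb{R}} \phi(x-t) f(t)\,dt$. A mean on $L^{\infty}(\mathbb{R})$ is an element $\Phi$ of the dual space $L^{\infty}(\mathbb{R})^*$ such that $\Phi(\phi) \ge 0$ whenever $\phi \ge 0$, and $\Phi(1) = 1$. A mean $\Phi$ is topologically invariant if $\Phi(g * \phi) = \Phi(\phi)$ for every $g \in P(\mathbb{R})$ and $\phi \in L^{\infty}(\mathbb{R})$. *)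

theory Defs
  imports "HOL-Analysis.Analysis" "HOL-Probability.Essential_Supremum"
begin

text \<open>
  Elements of \<open>L\<^sup>\<infinity>(\<real>)\<close> and \<open>L\<^sup>1(\<real>)\<close> are given by representatives; functions are not
  identified up to null sets.
\<close>

definition Linf :: "(real \<Rightarrow> complex) set" where
  "Linf = {\<phi> \<in> borel_measurable lebesgue. esssup lebesgue (\<lambda>x. ereal (cmod (\<phi> x))) < \<infinity>}"

definition Linf_norm :: "(real \<Rightarrow> complex) \<Rightarrow> real" where
  "Linf_norm \<phi> = real_of_ereal (esssup lebesgue (\<lambda>x. ereal (cmod (\<phi> x))))"

definition Linf_R :: "(real \<Rightarrow> complex) set" where
  "Linf_R = {\<phi> \<in> Linf. AE x in lebesgue. \<phi> x \<in> \<real>}"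

definition P_R :: "(real \<Rightarrow> real) set" where
  "P_R = {f. integrable lebesgue f \<and> (AE x in lebesgue. 0 \<le> f x) \<and> (\<integral>x. f x \<partial>lebesgue) = 1}"

definition conv :: "(real \<Rightarrow> real) \<Rightarrow> (real \<Rightarrow> complex) \<Rightarrow> real \<Rightarrow> complex" where
  "conv f \<phi> x = (\<integral>t. \<phi> (x - t) * complex_of_real (f t) \<partial>lebesgue)"

text \<open>
  Complex-linear functionals on \<open>Linf\<close> that are bounded for the essential-supremum seminorm.
  Boundedness makes them constant on almost-everywhere equality classes (lemma
  \<open>Linf_dual_cong\<close> below), so they are the elements of the dual of the quotient space
  \<open>L\<^sup>\<infinity>(\<real>)\<close>. The values of \<open>\<Phi>\<close> outside \<open>Linf\<close> are irrelevant.
\<close>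

definition Linf_dual :: "((real \<Rightarrow> complex) \<Rightarrow> complex) set" where
  "Linf_dual = {\<Phi>.
     (\<forall>\<phi>\<in>Linf. \<forall>\<psi>\<in>Linf. \<Phi> (\<lambda>x. \<phi> x + \<psi> x) = \<Phi> \<phi> + \<Phi> \<psi>) \<and>
     (\<forall>c. \<forall>\<phi>\<in>Linf. \<Phi> (\<lambda>x. c * \<phi> x) = c * \<Phi> \<phi>) \<and>
     (\<exists>K. \<forall>\<phi>\<in>Linf. cmod (\<Phi> \<phi>) \<le> K * Linf_norm \<phi>)}"

definition is_mean :: "((real \<Rightarrow> complex) \<Rightarrow> complex) \<Rightarrow> bool" where
  "is_mean \<Phi> \<longleftrightarrow> \<Phi> \<in> Linf_dual \<and>
     (\<forall>\<phi>\<in>Linf. (AE x in lebesgue. \<phi> x \<in> \<real>\<^sub>\<ge>\<^sub>0) \<longrightarrow> \<Phi> \<phi> \<in> \<real>\<^sub>\<ge>\<^sub>0) \<and>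
     \<Phi> (\<lambda>x. 1) = 1"

definition topologically_invariant :: "((real \<Rightarrow> complex) \<Rightarrow> complex) \<Rightarrow> bool" where
  "topologically_invariant \<Phi> \<longleftrightarrow> (\<forall>g\<in>P_R. \<forall>\<phi>\<in>Linf. \<Phi> (conv g \<phi>) = \<Phi> \<phi>)"

definition dilate :: "(real \<Rightarrow> real) \<Rightarrow> real \<Rightarrow> real \<Rightarrow> real" where
  "dilate f r x = inverse r * f (x / r)"

text \<open>
  Used for \<open>\<phi> \<in> Linf_R\<close> only, where the convolution is real-valued and \<open>Re\<close> merely
  changes its type.
\<close>

definition upper_F :: "(real \<Rightarrow> real) \<Rightarrow> (real \<Rightarrow> complex) \<Rightarrow> ereal" where
  "upper_F f \<phi> = Limsup at_top (\<lambda>r. SUP x. ereal (Re (conv (dilate f r) \<phi> x)))"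

lemma Linf_iff:
  "\<phi> \<in> Linf \<longleftrightarrow> \<phi> \<in> borel_measurable lebesgue \<and> (\<exists>C. AE x in lebesgue. cmod (\<phi> x) \<le> C)"
proof
  assume "\<phi> \<in> Linf"
  then have m: "\<phi> \<in> borel_measurable lebesgue"
    and l: "esssup lebesgue (\<lambda>x. ereal (cmod (\<phi> x))) < \<infinity>"
    by (auto simp: Linf_def)
  from l obtain C where C: "esssup lebesgue (\<lambda>x. ereal (cmod (\<phi> x))) < ereal C"
    using less_PInf_Ex_of_nat by fastforce
  have "AE x in lebesgue. ereal (cmod (\<phi> x)) \<le> esssup lebesgue (\<lambda>x. ereal (cmod (\<phi> x)))"
    by (rule esssup_AE)
  then have "AE x in lebesgue. cmod (\<phi> x) \<le> C"
    by eventually_elim (use C in \<open>metis ereal_less_eq(3) order.strict_implies_order order.trans\<close>)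
  with m show "\<phi> \<in> borel_measurable lebesgue \<and> (\<exists>C. AE x in lebesgue. cmod (\<phi> x) \<le> C)"
    by blast
next
  assume "\<phi> \<in> borel_measurable lebesgue \<and> (\<exists>C. AE x in lebesgue. cmod (\<phi> x) \<le> C)"
  then obtain C where m: "\<phi> \<in> borel_measurable lebesgue"
    and C: "AE x in lebesgue. cmod (\<phi> x) \<le> C" by blast
  have "esssup lebesgue (\<lambda>x. ereal (cmod (\<phi> x))) \<le> ereal C"
    by (rule esssup_I) (use m C in auto)
  with m show "\<phi> \<in> Linf" unfolding Linf_def
    using order_le_less_trans[of _ "ereal C" \<infinity>] by simp
qed

lemma Linf_dualD:
  assumes "\<Phi> \<in> Linf_dual" "\<phi> \<in> Linf"
  shows "\<psi> \<in> Linf \<Longrightarrow> \<Phi> (\<lambda>x. \<phi> x + \<psi> x) = \<Phi> \<phi> + \<Phi> \<psi>"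
    and "\<Phi> (\<lambda>x. c * \<phi> x) = c * \<Phi> \<phi>"
  using assms by (simp_all add: Linf_dual_def)

lemma Linf_dual_cong:
  assumes \<Phi>: "\<Phi> \<in> Linf_dual" and \<phi>: "\<phi> \<in> Linf" and \<psi>: "\<psi> \<in> Linf"
    and eq: "AE x in lebesgue. \<phi> x = \<psi> x"
  shows "\<Phi> \<phi> = \<Phi> \<psi>"
proof -
  define \<delta> where "\<delta> = (\<lambda>x. \<phi> x + (- 1) * \<psi> x)"
  have n: "(\<lambda>x. (- 1) * \<psi> x) \<in> Linf" using \<psi> by (simp add: Linf_iff)
  have m: "\<phi> \<in> borel_measurable lebesgue" "\<psi> \<in> borel_measurable lebesgue"
    using \<phi> \<psi> by (auto simp: Linf_iff)
  have md: "\<delta> \<in> borel_measurable lebesgue" using m by (simp add: \<delta>_def)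
  have ae: "AE x in lebesgue. cmod (\<delta> x) = 0" using eq by (simp add: \<delta>_def)
  have d: "\<delta> \<in> Linf" unfolding Linf_iff
    using md ae by (auto intro!: exI[of _ 0])
  have "esssup lebesgue (\<lambda>x. ereal (cmod (\<delta> x))) = esssup lebesgue (\<lambda>x::real. 0 :: ereal)"
    by (rule esssup_AE_cong) (use md ae in auto)
  also have "\<dots> = 0" by (rule esssup_const) simp
  finally have "Linf_norm \<delta> = 0" by (simp add: Linf_norm_def)
  moreover obtain K where "\<forall>\<phi>\<in>Linf. cmod (\<Phi> \<phi>) \<le> K * Linf_norm \<phi>"
    using \<Phi> by (auto simp: Linf_dual_def)
  ultimately have "\<Phi> \<delta> = 0" using d by fastforce
  moreover have "\<Phi> \<delta> = \<Phi> \<phi> + \<Phi> (\<lambda>x. (- 1) * \<psi> x)"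
    unfolding \<delta>_def by (rule Linf_dualD(1)[OF \<Phi> \<phi> n])
  moreover have "\<Phi> (\<lambda>x. (- 1) * \<psi> x) = (- 1) * \<Phi> \<psi>"
    by (rule Linf_dualD(2)[OF \<Phi> \<psi>])
  ultimately show ?thesis by simp
qed

lemma is_mean_real:
  assumes \<Phi>: "is_mean \<Phi>" and \<phi>: "\<phi> \<in> Linf_R"
  shows "\<Phi> \<phi> \<in> \<real>"
proof -
  have d: "\<Phi> \<in> Linf_dual"
    and pos: "\<forall>\<phi>\<in>Linf. (AE x in lebesgue. \<phi> x \<in> \<real>\<^sub>\<ge>\<^sub>0) \<longrightarrow> \<Phi> \<phi> \<in> \<real>\<^sub>\<ge>\<^sub>0"
    using \<Phi> by (auto simp only: is_mean_def)
  have l: "\<phi> \<in> Linf" and r: "AE x in lebesgue. \<phi> x \<in> \<real>" using \<phi> by (auto simp: Linf_R_def)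
  obtain C where m: "\<phi> \<in> borel_measurable lebesgue"
    and C: "AE x in lebesgue. cmod (\<phi> x) \<le> C" using l by (auto simp: Linf_iff)
  have one: "(\<lambda>x::real. 1 :: complex) \<in> Linf" by (auto simp: Linf_iff intro!: exI[of _ 1])
  have cst: "(\<lambda>x::real. complex_of_real C * 1) \<in> Linf"
    by (auto simp: Linf_iff intro!: exI[of _ "\<bar>C\<bar>"])
  have "AE x in lebesgue. cmod (\<phi> x + complex_of_real C * 1) \<le> 2 * \<bar>C\<bar>"
    using C
  proof eventually_elim
    case (elim x)
    then show ?case
      using norm_triangle_ineq[of "\<phi> x" "complex_of_real C * 1"] by simp
  qed
  then have s: "(\<lambda>x. \<phi> x + complex_of_real C * 1) \<in> Linf"
    using m by (auto simp: Linf_iff)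
  have "AE x in lebesgue. \<phi> x + complex_of_real C * 1 \<in> \<real>\<^sub>\<ge>\<^sub>0"
    using C r
  proof eventually_elim
    case (elim x)
    then show ?case
      using abs_Re_le_cmod[of "\<phi> x"]
      by (auto simp: complex_nonneg_Reals_iff complex_is_Real_iff)
  qed
  then have "\<Phi> (\<lambda>x. \<phi> x + complex_of_real C * 1) \<in> \<real>\<^sub>\<ge>\<^sub>0"
    using bspec[OF pos s] by simp
  moreover have "\<Phi> (\<lambda>x. \<phi> x + complex_of_real C * 1)
      = \<Phi> \<phi> + \<Phi> (\<lambda>x. complex_of_real C * 1)"
    by (rule Linf_dualD(1)[OF d l cst])
  moreover have "\<Phi> (\<lambda>x. complex_of_real C * 1) = complex_of_real C * \<Phi> (\<lambda>x. 1)"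
    by (rule Linf_dualD(2)[OF d one])
  moreover have "\<Phi> (\<lambda>x. 1) = 1" using \<Phi> by (simp add: is_mean_def)
  ultimately show ?thesis
    by (simp add: complex_nonneg_Reals_iff complex_is_Real_iff)
qed

end

theory Submission
  imports Defs
begin

text \<open>
  If \<open>\<Phi>\<close> is topologically invariant, then \<open>\<Phi>(\<phi>) = \<Phi>(f\<^sub>r * \<phi>) \<le> sup (f\<^sub>r * \<phi>)\<close> for every \<open>r\<close>.
  Conversely, \<open>f\<^sub>r * (g * \<phi> - \<phi>)\<close> is bounded by a constant times the \<open>g\<close>-average over \<open>s\<close> of
  \<open>\<parallel>f\<^sub>r(\<cdot> - s) - f\<^sub>r\<parallel>\<^sub>1 = \<parallel>f(\<cdot> - s/r) - f\<parallel>\<^sub>1\<close>, which tends to \<open>0\<close> as \<open>r \<rightarrow> \<infinity>\<close> by continuity of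
  translation in \<open>L\<^sup>1\<close> and dominated convergence. So the upper
  functional is at most \<open>0\<close> on the real part of \<open>c (g * \<phi> - \<phi>)\<close> for each unit \<open>c\<close>, and the cases
  \<open>c = \<plusminus>1, \<plusminus>\<i>\<close> force \<open>\<Phi>(g * \<phi> - \<phi>) = 0\<close>.
\<close>

section \<open>Continuity of translation in \<open>L\<^sup>1\<close>\<close>

text \<open>The L^1 modulus of continuity at a single shift. It is taken over \<open>lborel\<close>
  because product measurability and Fubini are applied to Borel representatives later on.\<close>

definition L1_modulus :: "(real \<Rightarrow> real) \<Rightarrow> real \<Rightarrow> real" where
  "L1_modulus f h = (\<integral>x. \<bar>f (x - h) - f x\<bar> \<partial>lborel)"

lemma integrable_lborel_translate:
  fixes f :: "real \<Rightarrow> real"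
  assumes "integrable lborel f"
  shows "integrable lborel (\<lambda>x. f (x - h))"
  using lborel_integrable_real_affine[OF assms, of 1 "-h"] by (simp add: add.commute)

lemma integral_lborel_translate:
  fixes f :: "real \<Rightarrow> 'a::{banach, second_countable_topology}"
  shows "(\<integral>x. f (x - h) \<partial>lborel) = (\<integral>x. f x \<partial>lborel)"
  using lborel_integral_real_affine[of 1 f "-h"] by (simp add: add.commute)

lemma L1_modulus_nonneg: "0 \<le> L1_modulus f h"
  by (simp add: L1_modulus_def)

lemma L1_modulus_le:
  assumes f: "integrable lborel f"
  shows "L1_modulus f h \<le> 2 * (\<integral>x. \<bar>f x\<bar> \<partial>lborel)"
proof -
  note i = f integrable_lborel_translate[OF f, of h]
  have "L1_modulus f h \<le> (\<integral>x. \<bar>f (x - h)\<bar> + \<bar>f x\<bar> \<partial>lborel)"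
    unfolding L1_modulus_def using i by (intro integral_mono) auto
  also have "\<dots> = 2 * (\<integral>x. \<bar>f x\<bar> \<partial>lborel)"
    using i integral_lborel_translate[of "\<lambda>x. \<bar>f x\<bar>" h] by simp
  finally show ?thesis .
qed

lemma L1_modulus_add:
  assumes f: "integrable lborel f" and g: "integrable lborel g"
  shows "L1_modulus (\<lambda>x. f x + g x) h \<le> L1_modulus f h + L1_modulus g h"
proof -
  note i = f g integrable_lborel_translate[OF f, of h] integrable_lborel_translate[OF g, of h]
  have "L1_modulus (\<lambda>x. f x + g x) h
      \<le> (\<integral>x. \<bar>f (x - h) - f x\<bar> + \<bar>g (x - h) - g x\<bar> \<partial>lborel)"
    unfolding L1_modulus_def using i by (intro integral_mono) auto
  also have "\<dots> = L1_modulus f h + L1_modulus g h"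
    unfolding L1_modulus_def using i by (intro Bochner_Integration.integral_add) auto
  finally show ?thesis .
qed

lemma L1_modulus_scale: "L1_modulus (\<lambda>x. c * f x) h = \<bar>c\<bar> * L1_modulus f h"
  unfolding L1_modulus_def
  by (simp add: right_diff_distrib[symmetric] abs_mult)

lemma L1_modulus_tendsto_add:
  assumes "integrable lborel f" "integrable lborel g"
    and "(L1_modulus f \<longlongrightarrow> 0) F" "(L1_modulus g \<longlongrightarrow> 0) F"
  shows "(L1_modulus (\<lambda>x. f x + g x) \<longlongrightarrow> 0) F"
proof (rule tendsto_sandwich[OF always_eventually always_eventually tendsto_const])
  show "((\<lambda>h. L1_modulus f h + L1_modulus g h) \<longlongrightarrow> 0) F"
    using tendsto_add[OF assms(3,4)] by simp
qed (use L1_modulus_add[OF assms(1,2)] L1_modulus_nonneg in auto)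

lemma L1_modulus_tendsto_scale:
  assumes "(L1_modulus f \<longlongrightarrow> 0) F"
  shows "(L1_modulus (\<lambda>x. c * f x) \<longlongrightarrow> 0) F"
  using tendsto_mult_right_zero[OF assms, of "\<bar>c\<bar>"] by (simp add: L1_modulus_scale[abs_def])

text \<open>Write \<open>f\<close> as \<open>s i\<close> plus a remainder. The modulus of the
  remainder is at most twice its L^1 norm, uniformly in \<open>h\<close>, and that norm tends to 0
  by dominated convergence. This carries every passage to a limit in the inductions below.\<close>

lemma L1_modulus_tendsto_limit:
  assumes s: "\<And>i. integrable lborel (s i)" "\<And>i. (L1_modulus (s i) \<longlongrightarrow> 0) F"
    and f: "integrable lborel f"
    and lim: "\<And>x. (\<lambda>i. s i x) \<longlonglongrightarrow> f x"
    and w: "integrable lborel w" "\<And>i x. \<bar>s i x\<bar> \<le> w x"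
  shows "(L1_modulus f \<longlongrightarrow> 0) F"
proof (rule tendstoI)
  fix e :: real assume e: "0 < e"
  have "(\<lambda>i. (\<integral>x. \<bar>f x - s i x\<bar> \<partial>lborel)) \<longlonglongrightarrow> integral\<^sup>L lborel (\<lambda>_::real. 0)"
  proof (rule integral_dominated_convergence[where w="\<lambda>x. \<bar>f x\<bar> + w x"])
    show "AE x in lborel. (\<lambda>i. \<bar>f x - s i x\<bar>) \<longlonglongrightarrow> 0"
    proof (intro always_eventually allI)
      fix x show "(\<lambda>i. \<bar>f x - s i x\<bar>) \<longlonglongrightarrow> 0"
        using tendsto_rabs[OF tendsto_diff[OF tendsto_const[of "f x"] lim[of x]]] by simp
    qed
    show "AE x in lborel. norm \<bar>f x - s i x\<bar> \<le> \<bar>f x\<bar> + w x" for i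
    proof (intro always_eventually allI)
      fix x show "norm \<bar>f x - s i x\<bar> \<le> \<bar>f x\<bar> + w x"
        using w(2)[of i x] by simp
    qed
  qed (use f s w in auto)
  \<comment> \<open>The bound \<open>e / 4\<close> is doubled by \<open>L1_modulus_le\<close>, so
    the remainder costs \<open>e / 2\<close> and \<open>s i\<close> may use the other half.\<close>
  then have "\<forall>\<^sub>F i in sequentially. (\<integral>x. \<bar>f x - s i x\<bar> \<partial>lborel) < e / 4"
    using e by (intro order_tendstoD(2)[of _ 0]) auto
  then obtain i where i: "(\<integral>x. \<bar>f x - s i x\<bar> \<partial>lborel) < e / 4"
    by (meson eventually_happens sequentially_bot)
  have d: "integrable lborel (\<lambda>x. f x - s i x)" using f s by auto
  have "L1_modulus f h < L1_modulus (s i) h + e / 2" for h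
    using L1_modulus_add[OF s(1) d, of i h] L1_modulus_le[OF d, of h] i by simp
  moreover have "\<forall>\<^sub>F h in F. L1_modulus (s i) h < e / 2"
    using s(2)[of i] e by (intro order_tendstoD(2)[of _ 0]) auto
  ultimately show "\<forall>\<^sub>F h in F. dist (L1_modulus f h) 0 < e"
  proof (elim eventually_mono)
    fix h assume *: "L1_modulus f h < L1_modulus (s i) h + e / 2" for h
    assume "L1_modulus (s i) h < e / 2"
    with *[of h] show "dist (L1_modulus f h) 0 < e"
      using L1_modulus_nonneg[of f h] by simp
  qed
qed

section \<open>From intervals to all integrable functions\<close>

lemma L1_modulus_tendsto_interval:
  fixes a b :: real
  shows "(L1_modulus (indicator {a..b}) \<longlongrightarrow> 0) (nhds 0)"
proof (rule tendsto_sandwich[OF always_eventually always_eventually tendsto_const])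
  have "((\<lambda>h::real. 4 * \<bar>h\<bar>) \<longlongrightarrow> 4 * \<bar>0\<bar>) (nhds 0)"
    by (intro tendsto_intros filterlim_ident)
  then show "((\<lambda>h::real. 4 * \<bar>h\<bar>) \<longlongrightarrow> 0) (nhds 0)" by simp
  show "\<forall>h. L1_modulus (indicator {a..b}) h \<le> 4 * \<bar>h\<bar>"
  proof
    fix h
    \<comment> \<open>If exactly one of \<open>x - h\<close> and \<open>x\<close> lies in the
      interval, the segment between them meets an endpoint, so \<open>x\<close> is within
      \<open>\<bar>h\<bar>\<close> of \<open>a\<close> or \<open>b\<close>. Each of the two windows
      has length \<open>2 * \<bar>h\<bar>\<close>.\<close>
    let ?u = "\<lambda>c::real. indicator {c - \<bar>h\<bar>..c + \<bar>h\<bar>} :: real \<Rightarrow> real"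
    have "L1_modulus (indicator {a..b}) h \<le> (\<integral>x. ?u a x + ?u b x \<partial>lborel)"
      unfolding L1_modulus_def
    proof (rule integral_mono)
      show "integrable lborel (\<lambda>x. \<bar>indicat_real {a..b} (x - h) - indicat_real {a..b} x\<bar>)"
        by (intro integrable_abs Bochner_Integration.integrable_diff integrable_lborel_translate
            integrable_real_indicator) (auto simp: emeasure_lborel_Icc_eq)
      show "integrable lborel (\<lambda>x. ?u a x + ?u b x)"
        by (intro Bochner_Integration.integrable_add integrable_real_indicator)
          (auto simp: emeasure_lborel_Icc_eq)
      show "\<bar>indicat_real {a..b} (x - h) - indicat_real {a..b} x\<bar> \<le> ?u a x + ?u b x" for x
        by (auto simp: indicator_def)
    qed
    also have "\<dots> = 4 * \<bar>h\<bar>" by simp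
    finally show "L1_modulus (indicator {a..b}) h \<le> 4 * \<bar>h\<bar>" .
  qed
qed (simp add: L1_modulus_nonneg)

text \<open>Dynkin's pi-lambda argument: the half-lines \<open>{..c}\<close> are stable under
  intersection and generate the Borel sets, and the property passes to complements and disjoint
  unions. Cutting with \<open>{a..b}\<close> keeps every indicator integrable, also after
  complementation.\<close>

lemma L1_modulus_tendsto_bounded_set:
  fixes A :: "real set"
  assumes A: "A \<in> sets borel"
  shows "(L1_modulus (indicator (A \<inter> {a..b})) \<longlongrightarrow> 0) (nhds 0)"
proof -
  have fin: "integrable lborel (indicat_real (B \<inter> {a..b}))" if "B \<in> sets borel" for B
  proof (rule integrable_real_indicator)
    have "emeasure lborel (B \<inter> {a..b}) \<le> emeasure lborel {a..b}"
      by (intro emeasure_mono) auto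
    then show "emeasure lborel (B \<inter> {a..b}) < \<infinity>"
      by (rule le_less_trans) (simp add: emeasure_lborel_Icc_eq)
  qed (use that in auto)
  have "Int_stable (range (atMost :: real \<Rightarrow> _))"
    by (auto simp: Int_stable_def)
  moreover have "range (atMost :: real \<Rightarrow> _) \<subseteq> Pow UNIV"
    by simp
  moreover have "A \<in> sigma_sets UNIV (range atMost)"
    using A by (simp add: borel_eq_atMost)
  ultimately show ?thesis
  proof (induction A rule: sigma_sets_induct_disjoint)
    case (basic A)
    then obtain c where c: "A = {..c}" by auto
    have "{..c} \<inter> {a..b} = {a..min c b}" by auto
    then show ?case using L1_modulus_tendsto_interval c by simp
  next
    case empty
    then show ?case by (simp add: L1_modulus_def[abs_def])
  next
    case (compl A)
    have "A \<in> sets borel" using compl by (simp add: borel_eq_atMost)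
    then have "(L1_modulus (\<lambda>x. indicat_real (UNIV \<inter> {a..b}) x + (-1) * indicat_real (A \<inter> {a..b}) x)
        \<longlongrightarrow> 0) (nhds 0)"
      using fin[of UNIV] fin[of A] L1_modulus_tendsto_interval[of a b] compl
      by (intro L1_modulus_tendsto_add L1_modulus_tendsto_scale) auto
    also have "(\<lambda>x. indicat_real (UNIV \<inter> {a..b}) x + (-1) * indicat_real (A \<inter> {a..b}) x)
        = indicator ((UNIV - A) \<inter> {a..b})"
      by (auto simp: indicator_def)
    finally show ?case .
  next
    case (union A)
    have b: "A i \<in> sets borel" for i using union(2) by (auto simp: borel_eq_atMost)
    \<comment> \<open>Disjointness makes the indicator of a finite union a sum of indicators, so
      additivity of the property covers finite unions. The countable union is then a limit dominated
      by the indicator of \<open>{a..b}\<close>.\<close>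
    have sum: "(\<Sum>i<n. indicat_real (A i \<inter> {a..b}) x) = indicator ((\<Union>i<n. A i) \<inter> {a..b}) x" for n x
    proof -
      have "disjoint_family_on A {..<n}"
        using union(1) by (auto simp: disjoint_family_on_def)
      then show ?thesis
        by (simp add: indicator_inter_arith indicator_UN_disjoint sum_distrib_right)
    qed
    have P: "(L1_modulus (indicat_real ((\<Union>i<n. A i) \<inter> {a..b})) \<longlongrightarrow> 0) (nhds 0)" for n
    proof -
      have "integrable lborel (\<lambda>x. \<Sum>i<n. indicat_real (A i \<inter> {a..b}) x) \<and>
          (L1_modulus (\<lambda>x. \<Sum>i<n. indicat_real (A i \<inter> {a..b}) x) \<longlongrightarrow> 0) (nhds 0)"
        by (induction n)
          (use fin[OF b] union(3) in \<open>auto intro!: L1_modulus_tendsto_add simp: L1_modulus_def[of "\<lambda>_. 0", abs_def]\<close>)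
      then show ?thesis by (simp add: sum[abs_def])
    qed
    show ?case
    proof (rule L1_modulus_tendsto_limit[OF _ P])
      fix x
      have "(\<lambda>n. indicat_real (\<Union>i<n. A i) x) \<longlonglongrightarrow> indicator (\<Union>i. A i) x"
        by (rule LIMSEQ_indicator_UN)
      then show "(\<lambda>n. indicat_real ((\<Union>i<n. A i) \<inter> {a..b}) x) \<longlonglongrightarrow> indicator ((\<Union>i. A i) \<inter> {a..b}) x"
        by (auto simp: indicator_inter_arith intro!: tendsto_intros)
    next
      show "\<bar>indicat_real ((\<Union>i<n. A i) \<inter> {a..b}) x\<bar> \<le> indicat_real (UNIV \<inter> {a..b}) x" for n x
        by (simp add: indicator_def)
    qed (use b fin[of UNIV] fin in auto)
  qed
qed

text \<open>Induction over integrable functions: indicators of sets of finite measure, sums, and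
  dominated limits.\<close>

proposition L1_translation_continuous:
  assumes "integrable lborel f"
  shows "(L1_modulus f \<longlongrightarrow> 0) (nhds 0)"
  using assms
proof induction
  case (base A c)
  have intA: "integrable lborel (indicat_real A)"
    using base by (intro integrable_real_indicator) auto
  \<comment> \<open>A set of finite measure may be unbounded; its cuts with \<open>[-n, n]\<close>
    are bounded and converge to it, dominated by the indicator of \<open>A\<close>.\<close>
  have int: "integrable lborel (indicat_real (A \<inter> {- real n..real n}))" for n
  proof (rule integrable_real_indicator)
    have "emeasure lborel (A \<inter> {- real n..real n}) \<le> emeasure lborel A"
      using base by (intro emeasure_mono) auto
    then show "emeasure lborel (A \<inter> {- real n..real n}) < \<infinity>"
      using base(2) by (rule le_less_trans)
  qed (use base in auto)
  have "(L1_modulus (indicator A) \<longlongrightarrow> 0) (nhds 0)"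
  proof (rule L1_modulus_tendsto_limit[OF int _ intA])
    show "(L1_modulus (indicat_real (A \<inter> {- real n..real n})) \<longlongrightarrow> 0) (nhds 0)" for n
      by (rule L1_modulus_tendsto_bounded_set) (use base in auto)
    fix x
    obtain N where "\<bar>x\<bar> \<le> real N" using real_arch_simple by blast
    then have "indicat_real (A \<inter> {- real n..real n}) x = indicator A x" if "N \<le> n" for n
      using that by (auto simp: indicator_def)
    then show "(\<lambda>n. indicat_real (A \<inter> {- real n..real n}) x) \<longlonglongrightarrow> indicator A x"
      by (intro tendsto_eventually eventually_sequentiallyI)
  next
    show "\<bar>indicat_real (A \<inter> {- real n..real n}) x\<bar> \<le> indicat_real A x" for n x
      by (simp add: indicator_def)
  qed (rule intA)
  from L1_modulus_tendsto_scale[OF this, of c] show ?case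
    by (simp add: mult.commute[of c])
next
  case (add f g)
  then show ?case by (intro L1_modulus_tendsto_add)
next
  case (lim f s)
  show ?case
  proof (rule L1_modulus_tendsto_limit[OF lim.hyps(1) lim.IH lim.hyps(4) lim.hyps(2)])
    \<comment> \<open>The factor 2 comes from the induction rule, whose approximants satisfy
      \<open>\<bar>s i x\<bar> \<le> 2 * \<bar>f x\<bar>\<close>.\<close>
    show "integrable lborel (\<lambda>x. 2 * \<bar>f x\<bar>)"
      using lim.hyps(4) by (intro integrable_mult_right integrable_abs)
    show "\<bar>s i x\<bar> \<le> 2 * \<bar>f x\<bar>" for i x
      using lim.hyps(3)[of x i] by simp
  qed simp
qed

section \<open>Affine substitution and convolution\<close>

lemma measurable_lebesgue_affine:
  fixes c t :: real
  assumes "c \<noteq> 0"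
  shows "(\<lambda>x. t + c * x) \<in> lebesgue \<rightarrow>\<^sub>M lebesgue"
  using lebesgue_affine_measurable[where c="\<lambda>_::real. c" and t=t] assms by simp

text \<open>Lebesgue measure is its own affine push-forward with constant density
  \<open>\<bar>c\<bar>\<close>; as this density is positive, both measures have the same null
  sets.\<close>

lemma AE_lebesgue_affine:
  fixes P :: "real \<Rightarrow> bool"
  assumes c: "c \<noteq> 0" and P: "AE x in lebesgue. P x"
  shows "AE x in lebesgue. P (t + c * x)"
proof (rule AE_distrD[OF measurable_lebesgue_affine[OF c, of t]])
  have "AE x in density (distr lebesgue lebesgue (\<lambda>x. t + c * x)) (\<lambda>_. ennreal \<bar>c\<bar>). P x"
    using P by (simp only: lebesgue_real_affine[OF c, symmetric])
  then show "AE x in distr lebesgue lebesgue (\<lambda>x. t + c * x). P x"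
    using c by (simp add: AE_density)
qed

text \<open>The same density identity gives the change of variables for integrands that are only
  Lebesgue measurable.\<close>

lemma
  fixes f :: "real \<Rightarrow> 'a::{banach, second_countable_topology}"
  assumes c: "c \<noteq> 0" and f: "integrable lebesgue f"
  shows integrable_lebesgue_affine: "integrable lebesgue (\<lambda>x. f (t + c * x))"
    and integral_lebesgue_affine:
      "(\<integral>x. f x \<partial>lebesgue) = \<bar>c\<bar> *\<^sub>R (\<integral>x. f (t + c * x) \<partial>lebesgue)"
proof -
  let ?D = "distr lebesgue lebesgue (\<lambda>x. t + c * x)"
  note [measurable] = measurable_lebesgue_affine[OF c, of t] borel_measurable_integrable[OF f]
  have "integrable (density ?D (\<lambda>_. ennreal \<bar>c\<bar>)) f"
    using f by (simp only: lebesgue_real_affine[OF c, symmetric])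
  then have "integrable ?D (\<lambda>x. \<bar>c\<bar> *\<^sub>R f x)"
    by (subst (asm) integrable_density) auto
  then have "integrable lebesgue (\<lambda>x. \<bar>c\<bar> *\<^sub>R f (t + c * x))"
    by (subst (asm) integrable_distr_eq) auto
  then have "integrable lebesgue (\<lambda>x. inverse \<bar>c\<bar> *\<^sub>R \<bar>c\<bar> *\<^sub>R f (t + c * x))"
    by (rule integrable_scaleR_right)
  then show "integrable lebesgue (\<lambda>x. f (t + c * x))"
    using c by simp
  have "(\<integral>x. f x \<partial>lebesgue) = (\<integral>x. f x \<partial>density ?D (\<lambda>_. ennreal \<bar>c\<bar>))"
    by (simp only: lebesgue_real_affine[OF c, symmetric])
  also have "\<dots> = (\<integral>x. \<bar>c\<bar> *\<^sub>R f x \<partial>?D)"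
    by (subst integral_density) auto
  also have "\<dots> = (\<integral>x. \<bar>c\<bar> *\<^sub>R f (t + c * x) \<partial>lebesgue)"
    by (subst integral_distr) auto
  finally show "(\<integral>x. f x \<partial>lebesgue) = \<bar>c\<bar> *\<^sub>R (\<integral>x. f (t + c * x) \<partial>lebesgue)"
    by simp
qed

lemma dilate_P_R:
  assumes f: "f \<in> P_R" and r: "r > 0"
  shows "dilate f r \<in> P_R"
proof -
  have c: "inverse r \<noteq> 0" using r by simp
  have i: "integrable lebesgue f" and p: "AE x in lebesgue. 0 \<le> f x" and "(\<integral>x. f x \<partial>lebesgue) = 1"
    using f by (auto simp: P_R_def)
  then have "inverse r * (\<integral>x. f (0 + inverse r * x) \<partial>lebesgue) = 1"
    using integral_lebesgue_affine[OF c i, of 0] r by simp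
  moreover have "dilate f r = (\<lambda>x. inverse r * f (0 + inverse r * x))"
    by (auto simp: dilate_def divide_inverse mult.commute)
  ultimately show ?thesis
    unfolding P_R_def
    using integrable_lebesgue_affine[OF c i, of 0] AE_lebesgue_affine[OF c p, of 0] r
    by auto
qed

section \<open>Convolution of Lebesgue measurable representatives\<close>

lemma conv_integrand_measurable:
  fixes \<phi> :: "real \<Rightarrow> complex"
  assumes \<phi>: "\<phi> \<in> borel_measurable lebesgue" and f: "f \<in> borel_measurable lebesgue"
  shows "(\<lambda>t. \<phi> (x - t) * complex_of_real (f t)) \<in> borel_measurable lebesgue"
proof -
  have "(\<lambda>t. \<phi> (x + (-1) * t)) \<in> borel_measurable lebesgue"
    by (rule measurable_compose[OF measurable_lebesgue_affine \<phi>]) simp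
  with f show ?thesis by simp
qed

lemma AE_lebesgue_reflect:
  fixes P :: "real \<Rightarrow> bool"
  assumes "AE x in lebesgue. P x"
  shows "AE t in lebesgue. P (x - t)"
  using AE_lebesgue_affine[of "-1", OF _ assms, of x] by simp

text \<open>Reflection about \<open>x\<close> preserves null sets, so the integrands agree almost
  everywhere for each fixed \<open>x\<close>. Hence representatives can be exchanged without
  altering the convolution at any point, and suprema over \<open>x\<close> are unaffected.\<close>

lemma conv_cong:
  assumes m: "\<phi> \<in> borel_measurable lebesgue" "f \<in> borel_measurable lebesgue"
      "\<psi> \<in> borel_measurable lebesgue" "g \<in> borel_measurable lebesgue"
    and \<phi>\<psi>: "AE x in lebesgue. \<phi> x = \<psi> x" and fg: "AE x in lebesgue. f x = g x"
  shows "conv f \<phi> x = conv g \<psi> x"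
  unfolding conv_def
proof (rule integral_cong_AE)
  show "AE t in lebesgue. \<phi> (x - t) * complex_of_real (f t) = \<psi> (x - t) * complex_of_real (g t)"
    using AE_lebesgue_reflect[OF \<phi>\<psi>, of x] fg by eventually_elim simp
qed (intro conv_integrand_measurable m)+

lemma conv_integrand_integrable:
  assumes \<phi>: "\<phi> \<in> Linf" and f: "integrable lebesgue f"
  shows "integrable lebesgue (\<lambda>t. \<phi> (x - t) * complex_of_real (f t))"
proof -
  obtain C where m: "\<phi> \<in> borel_measurable lebesgue" and C: "AE x in lebesgue. cmod (\<phi> x) \<le> C"
    using \<phi> by (auto simp: Linf_iff)
  show ?thesis
  proof (rule Bochner_Integration.integrable_bound)
    show "integrable lebesgue (\<lambda>t. C * f t)" using f by simp
    show "(\<lambda>t. \<phi> (x - t) * complex_of_real (f t)) \<in> borel_measurable lebesgue"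
      using m f by (intro conv_integrand_measurable) auto
    show "AE t in lebesgue. norm (\<phi> (x - t) * complex_of_real (f t)) \<le> norm (C * f t)"
      using AE_lebesgue_reflect[OF C, of x]
    proof eventually_elim
      case (elim t)
      then have "cmod (\<phi> (x - t)) \<le> \<bar>C\<bar>" by linarith
      then show ?case by (auto simp: norm_mult abs_mult intro: mult_right_mono)
    qed
  qed
qed

lemma norm_conv_le:
  assumes f: "f \<in> P_R" and m: "\<phi> \<in> borel_measurable lebesgue"
    and C: "AE x in lebesgue. cmod (\<phi> x) \<le> C"
  shows "cmod (conv f \<phi> x) \<le> C"
proof -
  have i: "integrable lebesgue f" and p: "AE x in lebesgue. 0 \<le> f x" and one: "(\<integral>x. f x \<partial>lebesgue) = 1"
    using f by (auto simp: P_R_def)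
  have "\<phi> \<in> Linf" using m C by (auto simp: Linf_iff)
  from conv_integrand_integrable[OF this i, of x]
  have "(\<integral>t. cmod (\<phi> (x - t) * complex_of_real (f t)) \<partial>lebesgue) \<le> (\<integral>t. C * f t \<partial>lebesgue)"
  proof (intro integral_mono_AE integrable_norm)
    show "integrable lebesgue (\<lambda>t. C * f t)" using i by simp
    show "AE t in lebesgue. norm (\<phi> (x - t) * complex_of_real (f t)) \<le> C * f t"
      using AE_lebesgue_reflect[OF C, of x] p
      by eventually_elim (auto simp: norm_mult intro: mult_right_mono)
  qed
  then have "cmod (conv f \<phi> x) \<le> (\<integral>t. C * f t \<partial>lebesgue)"
    unfolding conv_def by (rule order_trans[OF integral_norm_bound])
  then show ?thesis using one by simp
qed

lemma conv_add_scale: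
  assumes f: "integrable lebesgue f" and \<phi>: "\<phi> \<in> Linf" and \<psi>: "\<psi> \<in> Linf"
  shows "conv f (\<lambda>x. \<phi> x + c * \<psi> x) x = conv f \<phi> x + c * conv f \<psi> x"
proof -
  have "conv f (\<lambda>x. \<phi> x + c * \<psi> x) x
      = (\<integral>t. \<phi> (x - t) * complex_of_real (f t) + c * (\<psi> (x - t) * complex_of_real (f t)) \<partial>lebesgue)"
    unfolding conv_def by (simp add: algebra_simps)
  also have "\<dots> = conv f \<phi> x + c * conv f \<psi> x"
    unfolding conv_def using conv_integrand_integrable[OF \<phi> f] conv_integrand_integrable[OF \<psi> f]
    by simp
  finally show ?thesis .
qed

lemma conv_of_real:
  "conv f (\<lambda>x. complex_of_real (u x)) x = complex_of_real (\<integral>t. u (x - t) * f t \<partial>lebesgue)"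
  unfolding conv_def by (simp flip: of_real_mult)

text \<open>Integration against a real kernel commutes with taking real parts. The factor
  \<open>c\<close> selects the component of \<open>\<psi>\<close> to be tested, since the upper
  functional is compared only on real-valued functions.\<close>

lemma Re_conv_of_real_Re:
  assumes f: "integrable lebesgue f" and \<psi>: "\<psi> \<in> Linf"
  shows "Re (conv f (\<lambda>x. complex_of_real (Re (c * \<psi> x))) x) = Re (c * conv f \<psi> x)"
proof -
  have "Re (c * conv f \<psi> x) = Re (\<integral>t. c * (\<psi> (x - t) * complex_of_real (f t)) \<partial>lebesgue)"
    by (simp add: conv_def)
  also have "\<dots> = (\<integral>t. Re (c * (\<psi> (x - t) * complex_of_real (f t))) \<partial>lebesgue)"
    using conv_integrand_integrable[OF \<psi> f, of x]
    by (intro integral_Re[symmetric]) simp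
  also have "\<dots> = (\<integral>t. Re (c * \<psi> (x - t)) * f t \<partial>lebesgue)"
    by (simp flip: mult.assoc)
  finally show ?thesis
    by (simp only: conv_of_real Re_complex_of_real)
qed

section \<open>Borel representatives\<close>

lemma lebesgue_integrable_borel_rep:
  fixes f :: "real \<Rightarrow> real"
  assumes f: "integrable lebesgue f"
  obtains g where "integrable lborel g" "AE x in lebesgue. f x = g x"
proof -
  obtain g where g: "g \<in> borel_measurable lborel" and e: "AE x in lborel. f x = g x"
    using completion_ex_borel_measurable_real[OF borel_measurable_integrable[OF f]] by blast
  then have e': "AE x in lebesgue. f x = g x" by (intro AE_completion)
  have "integrable lebesgue g"
    by (rule integrable_cong_AE_imp[OF f]) (use g e' in \<open>auto intro: measurable_completion\<close>)
  then have "integrable lborel g"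
    using integrable_completion[OF g] by simp
  with e' that show thesis by blast
qed

lemma Linf_borel_rep:
  assumes \<phi>: "\<phi> \<in> Linf"
  obtains \<psi> C where "\<psi> \<in> borel_measurable borel" "\<And>x. cmod (\<psi> x) \<le> C" "AE x in lebesgue. \<phi> x = \<psi> x"
proof -
  obtain C where m: "\<phi> \<in> borel_measurable lebesgue" and C: "AE x in lebesgue. cmod (\<phi> x) \<le> C"
    using \<phi> by (auto simp: Linf_iff)
  have "(\<lambda>x. Re (\<phi> x)) \<in> borel_measurable lebesgue" "(\<lambda>x. Im (\<phi> x)) \<in> borel_measurable lebesgue"
    using m by simp_all
  then obtain u v where [measurable]: "u \<in> borel_measurable lborel" "v \<in> borel_measurable lborel"
    and "AE x in lborel. Re (\<phi> x) = u x" "AE x in lborel. Im (\<phi> x) = v x"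
    by (blast dest!: completion_ex_borel_measurable_real)
  then have uv: "AE x in lebesgue. Re (\<phi> x) = u x" "AE x in lebesgue. Im (\<phi> x) = v x"
    by (auto intro: AE_completion)
  define w where "w x = complex_of_real (u x) + \<i> * complex_of_real (v x)" for x
  \<comment> \<open>The essential bound may fail for \<open>w\<close> on a null set; replacing the
    large values by 0 makes it hold everywhere. Using \<open>\<bar>C\<bar>\<close> ensures that the
    value 0 also obeys the bound.\<close>
  define \<psi> where "\<psi> x = (if cmod (w x) \<le> \<bar>C\<bar> then w x else 0)" for x
  have "\<psi> \<in> borel_measurable borel"
    unfolding \<psi>_def w_def by measurable
  moreover have "cmod (\<psi> x) \<le> \<bar>C\<bar>" for x
    by (simp add: \<psi>_def)
  moreover have "AE x in lebesgue. \<phi> x = \<psi> x"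
    using C uv
  proof eventually_elim
    case (elim x)
    then have "w x = \<phi> x" by (simp add: w_def complex_eq_iff)
    with elim show ?case by (simp add: \<psi>_def)
  qed
  ultimately show thesis by (rule that)
qed

lemma conv_eq_lborel:
  assumes [measurable]: "\<phi> \<in> borel_measurable borel" "f \<in> borel_measurable borel"
  shows "conv f \<phi> x = (\<integral>t. \<phi> (x - t) * complex_of_real (f t) \<partial>lborel)"
  unfolding conv_def by (rule integral_completion) measurable

lemma conv_borel_measurable:
  assumes [measurable]: "\<phi> \<in> borel_measurable borel" "f \<in> borel_measurable borel"
  shows "conv f \<phi> \<in> borel_measurable borel"
proof -
  have "(\<lambda>x. \<integral>t. \<phi> (x - t) * complex_of_real (f t) \<partial>lborel) \<in> borel_measurable borel"
    by measurable
  also have "(\<lambda>x. \<integral>t. \<phi> (x - t) * complex_of_real (f t) \<partial>lborel) = conv f \<phi>"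
    using assms by (auto simp: conv_eq_lborel)
  finally show ?thesis .
qed

text \<open>The essential point is measurability: the convolution equals, at every point, that of
  Borel representatives, where measurability of parameter integrals applies. Boundedness is
  \<open>norm_conv_le\<close>.\<close>

lemma conv_in_Linf:
  assumes f: "f \<in> P_R" and \<phi>: "\<phi> \<in> Linf"
  shows "conv f \<phi> \<in> Linf"
proof -
  have i: "integrable lebesgue f" using f by (simp add: P_R_def)
  obtain g where g: "integrable lborel g" "AE x in lebesgue. f x = g x"
    by (rule lebesgue_integrable_borel_rep[OF i])
  obtain \<psi> C where \<psi>: "\<psi> \<in> borel_measurable borel" "\<And>x. cmod (\<psi> x) \<le> C" "AE x in lebesgue. \<phi> x = \<psi> x"
    using Linf_borel_rep[OF \<phi>] by blast
  have gm: "g \<in> borel_measurable borel" using g by auto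
  have m: "\<phi> \<in> borel_measurable lebesgue" using \<phi> by (simp add: Linf_iff)
  have "conv f \<phi> = conv g \<psi>"
  proof
    fix x show "conv f \<phi> x = conv g \<psi> x"
      by (rule conv_cong) (use m i gm \<psi> g in \<open>auto intro: measurable_completion\<close>)
  qed
  then have "conv f \<phi> \<in> borel_measurable lebesgue"
    using conv_borel_measurable[OF \<psi>(1) gm] by (simp add: measurable_completion)
  moreover have "AE x in lebesgue. cmod (\<phi> x) \<le> C"
    using \<psi>(3) by eventually_elim (simp add: \<psi>(2))
  ultimately show ?thesis
    using norm_conv_le[OF f m] by (auto simp: Linf_iff)
qed

section \<open>Convolution with dilates\<close>

lemma L1_modulus_measurable:
  assumes [measurable]: "f \<in> borel_measurable borel"
  shows "L1_modulus f \<in> borel_measurable borel"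
  unfolding L1_modulus_def[abs_def] by measurable

text \<open>Substituting \<open>r * x\<close> for \<open>x\<close> cancels the normalising factor of
  the dilate. A fixed shift \<open>s\<close> thus becomes the small shift \<open>s / r\<close> when
  \<open>r\<close> is large.\<close>

lemma L1_modulus_dilate:
  assumes r: "r > 0"
  shows "L1_modulus (dilate f r) s = L1_modulus f (s / r)"
proof -
  have "L1_modulus (dilate f r) s
      = r * (\<integral>x. \<bar>dilate f r (r * x - s) - dilate f r (r * x)\<bar> \<partial>lborel)"
    unfolding L1_modulus_def using r
    by (subst lborel_integral_real_affine[of r _ 0]) simp_all
  also have "\<dots> = (\<integral>x. r * \<bar>dilate f r (r * x - s) - dilate f r (r * x)\<bar> \<partial>lborel)"
    by simp
  also have "\<dots> = L1_modulus f (s / r)"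
    unfolding L1_modulus_def
  proof (rule Bochner_Integration.integral_cong[OF refl])
    fix x
    have "dilate f r (r * x - s) - dilate f r (r * x) = inverse r * (f (x - s / r) - f x)"
      using r by (simp add: dilate_def diff_divide_distrib right_diff_distrib)
    then show "r * \<bar>dilate f r (r * x - s) - dilate f r (r * x)\<bar> = \<bar>f (x - s / r) - f x\<bar>"
      using r by (simp add: abs_mult)
  qed
  finally show ?thesis .
qed

lemma integrable_mult_L1_modulus:
  assumes f: "integrable lborel f" and g: "integrable lborel g"
  shows "integrable lborel (\<lambda>s. \<bar>g s\<bar> * L1_modulus f (s / r))"
proof (rule Bochner_Integration.integrable_bound)
  let ?K = "2 * (\<integral>x. \<bar>f x\<bar> \<partial>lborel)"
  show "integrable lborel (\<lambda>s. ?K * \<bar>g s\<bar>)"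
    using g by (intro integrable_mult_right integrable_abs)
  have [measurable]: "L1_modulus f \<in> borel_measurable borel" "g \<in> borel_measurable borel"
    using f g by (auto intro: L1_modulus_measurable)
  show "(\<lambda>s. \<bar>g s\<bar> * L1_modulus f (s / r)) \<in> borel_measurable lborel"
    by measurable
  show "AE s in lborel. norm (\<bar>g s\<bar> * L1_modulus f (s / r)) \<le> norm (?K * \<bar>g s\<bar>)"
  proof (intro always_eventually allI)
    fix s
    have "\<bar>g s\<bar> * L1_modulus f (s / r) \<le> \<bar>g s\<bar> * ?K"
      by (intro mult_left_mono L1_modulus_le f) simp
    then show "norm (\<bar>g s\<bar> * L1_modulus f (s / r)) \<le> norm (?K * \<bar>g s\<bar>)"
      by (simp add: abs_mult L1_modulus_nonneg mult.commute)
  qed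
qed

text \<open>Dominated convergence: for fixed \<open>s\<close> the modulus tends to 0 by continuity
  of translation, and it never exceeds twice the L^1 norm of \<open>f\<close>.\<close>

lemma L1_modulus_average_tendsto_0:
  assumes f: "integrable lborel f" and g: "integrable lborel g"
  shows "((\<lambda>r. \<integral>s. \<bar>g s\<bar> * L1_modulus f (s / r) \<partial>lborel) \<longlongrightarrow> 0) at_top"
proof -
  let ?K = "2 * (\<integral>x. \<bar>f x\<bar> \<partial>lborel)"
  have "((\<lambda>r. \<integral>s. \<bar>g s\<bar> * L1_modulus f (s / r) \<partial>lborel)
      \<longlongrightarrow> integral\<^sup>L lborel (\<lambda>_::real. 0)) at_top"
  proof (rule integral_dominated_convergence_at_top[where w="\<lambda>s. ?K * \<bar>g s\<bar>"])
    show "integrable lborel (\<lambda>s. ?K * \<bar>g s\<bar>)"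
      using g by (intro integrable_mult_right integrable_abs)
    show "(\<lambda>s. \<bar>g s\<bar> * L1_modulus f (s / r)) \<in> borel_measurable lborel" for r
      using integrable_mult_L1_modulus[OF f g] by (rule borel_measurable_integrable)
    show "\<forall>\<^sub>F r in at_top. AE s in lborel. norm (\<bar>g s\<bar> * L1_modulus f (s / r)) \<le> ?K * \<bar>g s\<bar>"
    proof (intro always_eventually allI)
      fix r s :: real
      have "\<bar>g s\<bar> * L1_modulus f (s / r) \<le> \<bar>g s\<bar> * ?K"
        by (intro mult_left_mono L1_modulus_le f) simp
      then show "norm (\<bar>g s\<bar> * L1_modulus f (s / r)) \<le> ?K * \<bar>g s\<bar>"
        by (simp add: abs_mult L1_modulus_nonneg mult.commute)
    qed
    show "AE s in lborel. ((\<lambda>r. \<bar>g s\<bar> * L1_modulus f (s / r)) \<longlongrightarrow> 0) at_top"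
    proof (intro always_eventually allI)
      fix s :: real
      have "((\<lambda>r. s / r) \<longlongrightarrow> 0) at_top"
        by (intro tendsto_divide_0[OF tendsto_const] filterlim_at_top_imp_at_infinity filterlim_ident)
      \<comment> \<open>Continuity was stated for \<open>nhds 0\<close> and not for a punctured
        neighbourhood, so \<open>s = 0\<close>, where the shift is constantly 0, is covered.\<close>
      from filterlim_compose[OF L1_translation_continuous[OF f] this]
      show "((\<lambda>r. \<bar>g s\<bar> * L1_modulus f (s / r)) \<longlongrightarrow> 0) at_top"
        by (rule tendsto_mult_right_zero)
    qed
  qed simp
  then show ?thesis by simp
qed

text \<open>
  By Fubini, \<open>f * (g * \<phi>) - f * \<phi>\<close> is the \<open>g\<close>-average over \<open>s\<close> of \<open>\<phi>\<close> convolved with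
  \<open>f(\<cdot> - s) - f\<close>.
\<close>

lemma norm_conv_conv_diff_le:
  assumes \<phi>[measurable]: "\<phi> \<in> borel_measurable borel" and C: "\<And>x. cmod (\<phi> x) \<le> C"
    and f: "integrable lborel f" and g: "integrable lborel g" and g1: "(\<integral>x. g x \<partial>lborel) = 1"
  shows "cmod (conv f (conv g \<phi>) x - conv f \<phi> x) \<le> C * (\<integral>s. \<bar>g s\<bar> * L1_modulus f s \<partial>lborel)"
proof -
  have [measurable]: "f \<in> borel_measurable borel" "g \<in> borel_measurable borel"
    using f g by auto
  have C0: "0 \<le> C" using C[of 0] norm_ge_zero order_trans by blast
  \<comment> \<open>\<open>k\<close> is the joint integrand of the iterated convolution at
    \<open>x\<close>, \<open>A s\<close> is \<open>\<phi>\<close> convolved with the translate of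
    \<open>f\<close> by \<open>s\<close>, and \<open>B\<close> is the unshifted value
    \<open>conv f \<phi> x\<close>.\<close>
  define k where "k s t = \<phi> (x - t - s) * complex_of_real (g s) * complex_of_real (f t)" for s t
  define A where "A s = (\<integral>t. \<phi> (x - t) * complex_of_real (f (t - s)) \<partial>lborel)" for s
  define B where "B = (\<integral>t. \<phi> (x - t) * complex_of_real (f t) \<partial>lborel)"
  have bounded_int: "integrable lborel (\<lambda>t. \<phi> (x - t) * complex_of_real (h t))"
    if h: "integrable lborel h" for h :: "real \<Rightarrow> real"
  proof (rule Bochner_Integration.integrable_bound)
    show "integrable lborel (\<lambda>t. C * h t)" using h by simp
    have [measurable]: "h \<in> borel_measurable borel" using h by auto
    show "(\<lambda>t. \<phi> (x - t) * complex_of_real (h t)) \<in> borel_measurable lborel" by measurable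
    show "AE t in lborel. norm (\<phi> (x - t) * complex_of_real (h t)) \<le> norm (C * h t)"
      using C0 by (intro always_eventually allI) (simp add: norm_mult abs_mult mult_right_mono C)
  qed
  have k: "integrable (lborel \<Otimes>\<^sub>M lborel) (case_prod k)"
  proof (rule Bochner_Integration.integrable_bound)
    show "integrable (lborel \<Otimes>\<^sub>M lborel) (\<lambda>(s, t). C * \<bar>g s\<bar> * \<bar>f t\<bar>)"
    proof (rule lborel_pair.Fubini_integrable)
      show "integrable lborel (\<lambda>s. \<integral>t. norm (case (s, t) of (s, t) \<Rightarrow> C * \<bar>g s\<bar> * \<bar>f t\<bar>) \<partial>lborel)"
        using g by (simp add: abs_mult)
    qed (use f in auto)
    show "case_prod k \<in> borel_measurable (lborel \<Otimes>\<^sub>M lborel)"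
      unfolding k_def by measurable
    have "cmod (k s t) \<le> \<bar>C * \<bar>g s\<bar> * \<bar>f t\<bar>\<bar>" for s t
    proof -
      have "cmod (k s t) = cmod (\<phi> (x - t - s)) * (\<bar>g s\<bar> * \<bar>f t\<bar>)"
        by (simp add: k_def norm_mult)
      also have "\<dots> \<le> C * (\<bar>g s\<bar> * \<bar>f t\<bar>)"
        by (intro mult_right_mono C) simp
      finally show ?thesis using C0 by (simp add: abs_mult mult.assoc)
    qed
    then show "AE z in lborel \<Otimes>\<^sub>M lborel. norm (case_prod k z) \<le> norm (case z of (s, t) \<Rightarrow> C * \<bar>g s\<bar> * \<bar>f t\<bar>)"
      by (simp add: split_beta)
  qed
  \<comment> \<open>Replacing \<open>t\<close> by \<open>t - s\<close> moves the shift from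
    \<open>\<phi>\<close>, which need not be continuous, to the integrable function
    \<open>f\<close>.\<close>
  have kA: "(\<integral>t. k s t \<partial>lborel) = complex_of_real (g s) * A s" for s
  proof -
    have "(\<integral>t. k s t \<partial>lborel) = (\<integral>t. k s (t - s) \<partial>lborel)"
      by (rule integral_lborel_translate[symmetric])
    also have "\<dots> = (\<integral>t. complex_of_real (g s) * (\<phi> (x - t) * complex_of_real (f (t - s))) \<partial>lborel)"
      by (simp add: k_def ac_simps)
    finally show ?thesis by (simp add: A_def)
  qed
  have gA: "integrable lborel (\<lambda>s. complex_of_real (g s) * A s)"
    using lborel_pair.integrable_fst[OF k] by (simp add: kA)
  have gB: "integrable lborel (\<lambda>s. complex_of_real (g s) * B)"
    using g by simp
  have "conv f (conv g \<phi>) x = (\<integral>t. (\<integral>s. k s t \<partial>lborel) \<partial>lborel)"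
  proof -
    have "conv f (conv g \<phi>) x = (\<integral>t. conv g \<phi> (x - t) * complex_of_real (f t) \<partial>lborel)"
      by (intro conv_eq_lborel conv_borel_measurable) measurable
    also have "\<dots> = (\<integral>t. (\<integral>s. k s t \<partial>lborel) \<partial>lborel)"
      by (simp add: conv_eq_lborel k_def)
    finally show ?thesis .
  qed
  also have "\<dots> = (\<integral>s. complex_of_real (g s) * A s \<partial>lborel)"
    using lborel_pair.Fubini_integral[OF k] by (simp add: kA)
  finally have 1: "conv f (conv g \<phi>) x = (\<integral>s. complex_of_real (g s) * A s \<partial>lborel)" .
  \<comment> \<open>Total mass 1 of \<open>g\<close> turns the constant \<open>B\<close> into a
    \<open>g\<close>-average, so that it can be subtracted under the integral over
    \<open>s\<close>.\<close>
  have 2: "conv f \<phi> x = (\<integral>s. complex_of_real (g s) * B \<partial>lborel)"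
    using g1 by (simp add: conv_eq_lborel B_def)
  have AB: "cmod (A s - B) \<le> C * L1_modulus f s" for s
  proof -
    note i = bounded_int[OF integrable_lborel_translate[OF f]] bounded_int[OF f]
    have "A s - B = (\<integral>t. \<phi> (x - t) * complex_of_real (f (t - s) - f t) \<partial>lborel)"
      unfolding A_def B_def
      by (subst Bochner_Integration.integral_diff[symmetric, OF i]) (simp add: algebra_simps)
    also have "cmod \<dots> \<le> (\<integral>t. cmod (\<phi> (x - t) * complex_of_real (f (t - s) - f t)) \<partial>lborel)"
      by (rule integral_norm_bound)
    also have "\<dots> \<le> (\<integral>t. C * \<bar>f (t - s) - f t\<bar> \<partial>lborel)"
    proof (rule integral_mono)
      have d: "integrable lborel (\<lambda>t. f (t - s) - f t)"
        using f integrable_lborel_translate[OF f] by auto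
      show "integrable lborel (\<lambda>t. cmod (\<phi> (x - t) * complex_of_real (f (t - s) - f t)))"
        by (rule integrable_norm[OF bounded_int[OF d]])
      show "integrable lborel (\<lambda>t. C * \<bar>f (t - s) - f t\<bar>)"
        by (intro integrable_mult_right integrable_abs d)
      show "cmod (\<phi> (x - t) * complex_of_real (f (t - s) - f t)) \<le> C * \<bar>f (t - s) - f t\<bar>" for t
        unfolding norm_mult norm_of_real by (intro mult_right_mono C) simp
    qed
    finally show ?thesis by (simp add: L1_modulus_def)
  qed
  have "conv f (conv g \<phi>) x - conv f \<phi> x = (\<integral>s. complex_of_real (g s) * (A s - B) \<partial>lborel)"
    unfolding 1 2 by (subst Bochner_Integration.integral_diff[symmetric, OF gA gB]) (simp add: algebra_simps)
  also have "cmod \<dots> \<le> (\<integral>s. cmod (complex_of_real (g s) * (A s - B)) \<partial>lborel)"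
    by (rule integral_norm_bound)
  also have "\<dots> \<le> (\<integral>s. C * (\<bar>g s\<bar> * L1_modulus f s) \<partial>lborel)"
  proof (rule integral_mono)
    show "integrable lborel (\<lambda>s. cmod (complex_of_real (g s) * (A s - B)))"
      using Bochner_Integration.integrable_diff[OF gA gB]
      by (intro integrable_norm) (simp add: algebra_simps)
    show "integrable lborel (\<lambda>s. C * (\<bar>g s\<bar> * L1_modulus f s))"
      using integrable_mult_L1_modulus[OF f g, of 1] by simp
    show "cmod (complex_of_real (g s) * (A s - B)) \<le> C * (\<bar>g s\<bar> * L1_modulus f s)" for s
      using mult_left_mono[OF AB[of s], of "\<bar>g s\<bar>"] by (simp add: norm_mult ac_simps)
  qed
  finally show ?thesis by simp
qed

text \<open>Borel representatives reduce this to \<open>norm_conv_conv_diff_le\<close> applied to a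
  dilate. The bound \<open>W\<close> is independent of \<open>x\<close>, which is what controls the
  supremum in \<open>upper_F\<close>.\<close>

proposition conv_dilate_diff_tendsto_0:
  assumes f: "f \<in> P_R" and g: "g \<in> P_R" and \<phi>: "\<phi> \<in> Linf"
  obtains W where "(W \<longlongrightarrow> 0) at_top"
    and "\<And>r x. r > 0 \<Longrightarrow> cmod (conv (dilate f r) (\<lambda>x. conv g \<phi> x + (-1) * \<phi> x) x) \<le> W r"
proof -
  have fi: "integrable lebesgue f" and gi: "integrable lebesgue g" and g1: "(\<integral>x. g x \<partial>lebesgue) = 1"
    using f g by (auto simp: P_R_def)
  obtain f' where f': "integrable lborel f'" "AE x in lebesgue. f x = f' x"
    by (rule lebesgue_integrable_borel_rep[OF fi])
  obtain g' where g': "integrable lborel g'" "AE x in lebesgue. g x = g' x"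
    by (rule lebesgue_integrable_borel_rep[OF gi])
  obtain \<psi> C where \<psi>: "\<psi> \<in> borel_measurable borel" "\<And>x. cmod (\<psi> x) \<le> C"
      "AE x in lebesgue. \<phi> x = \<psi> x"
    using Linf_borel_rep[OF \<phi>] by blast
  have borel: "g' \<in> borel_measurable borel" using g' by auto
  have leb: "\<phi> \<in> borel_measurable lebesgue" "\<psi> \<in> borel_measurable lebesgue"
      "g \<in> borel_measurable lebesgue" "g' \<in> borel_measurable lebesgue"
    using \<phi> \<psi> gi borel by (auto simp: Linf_iff intro: measurable_completion)
  have g'1: "(\<integral>x. g' x \<partial>lborel) = 1"
  proof -
    have "(\<integral>x. g x \<partial>lebesgue) = (\<integral>x. g' x \<partial>lebesgue)"
      by (rule integral_cong_AE) (use leb g' in auto)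
    then show ?thesis using g1 borel by (simp add: integral_completion)
  qed
  have gg': "conv g \<phi> = conv g' \<psi>"
    by (rule ext, rule conv_cong) (use leb \<psi> g' in auto)
  define W where "W r = C * (\<integral>s. \<bar>g' s\<bar> * L1_modulus f' (s / r) \<partial>lborel)" for r
  have "(W \<longlongrightarrow> 0) at_top"
    unfolding W_def by (intro tendsto_mult_right_zero L1_modulus_average_tendsto_0 f' g')
  moreover have "cmod (conv (dilate f r) (\<lambda>x. conv g \<phi> x + (-1) * \<phi> x) x) \<le> W r" if r: "r > 0" for r x
  proof -
    have c: "inverse r \<noteq> 0" using r by simp
    have dil: "dilate h r = (\<lambda>x. inverse r * h (0 + inverse r * x))" for h
      by (auto simp: dilate_def divide_inverse mult.commute)
    have F: "integrable lebesgue (dilate f r)"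
      using dilate_P_R[OF f r] by (simp add: P_R_def)
    have F': "integrable lborel (dilate f' r)"
      unfolding dil by (intro integrable_mult_right lborel_integrable_real_affine f' c)
    \<comment> \<open>Dilation preserves null sets, so the Borel representative of \<open>f\<close>
      dilates to one of the dilate.\<close>
    have ae: "AE x in lebesgue. dilate f r x = dilate f' r x"
      using AE_lebesgue_affine[OF c f'(2), of 0] unfolding dil by eventually_elim simp
    have m: "dilate f r \<in> borel_measurable lebesgue" "dilate f' r \<in> borel_measurable lebesgue"
      using F F' by (auto intro: measurable_completion)
    have "conv g' \<psi> \<in> borel_measurable lebesgue"
      using conv_borel_measurable[OF \<psi>(1) borel] by (simp add: measurable_completion)
    then have 1: "conv (dilate f r) (conv g \<phi>) x = conv (dilate f' r) (conv g' \<psi>) x"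
      unfolding gg' by (intro conv_cong m ae) auto
    have 2: "conv (dilate f r) \<phi> x = conv (dilate f' r) \<psi> x"
      by (intro conv_cong m ae leb \<psi>)
    have "conv (dilate f r) (\<lambda>x. conv g \<phi> x + (-1) * \<phi> x) x
        = conv (dilate f' r) (conv g' \<psi>) x - conv (dilate f' r) \<psi> x"
      using conv_add_scale[OF F conv_in_Linf[OF g \<phi>] \<phi>, of "-1" x] 1 2 by simp
    also have "cmod \<dots> \<le> C * (\<integral>s. \<bar>g' s\<bar> * L1_modulus (dilate f' r) s \<partial>lborel)"
      by (rule norm_conv_conv_diff_le[OF \<psi>(1,2) F' g'(1) g'1])
    also have "\<dots> = W r" by (simp add: W_def L1_modulus_dilate[OF r])
    finally show ?thesis .
  qed
  ultimately show thesis by (rule that)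
qed

section \<open>Means\<close>

lemma Linf_add_scale:
  assumes "\<phi> \<in> Linf" "\<psi> \<in> Linf"
  shows "(\<lambda>x. \<phi> x + c * \<psi> x) \<in> Linf"
proof -
  obtain C D where m: "\<phi> \<in> borel_measurable lebesgue" "\<psi> \<in> borel_measurable lebesgue"
    and CD: "AE x in lebesgue. cmod (\<phi> x) \<le> C" "AE x in lebesgue. cmod (\<psi> x) \<le> D"
    using assms by (auto simp: Linf_iff)
  have "AE x in lebesgue. cmod (\<phi> x + c * \<psi> x) \<le> C + cmod c * D"
    using CD
  proof eventually_elim
    case (elim x)
    have "cmod (\<phi> x + c * \<psi> x) \<le> cmod (\<phi> x) + cmod c * cmod (\<psi> x)"
      using norm_triangle_ineq[of "\<phi> x" "c * \<psi> x"] by (simp add: norm_mult)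
    also have "\<dots> \<le> C + cmod c * D"
      using elim by (intro add_mono mult_left_mono) auto
    finally show ?case .
  qed
  with m show ?thesis by (auto simp: Linf_iff)
qed

lemma Linf_scale:
  assumes "\<psi> \<in> Linf"
  shows "(\<lambda>x. c * \<psi> x) \<in> Linf"
proof -
  have "(\<lambda>x. 0) \<in> Linf" by (auto simp: Linf_iff intro: exI[of _ 0])
  from Linf_add_scale[OF this assms, of c] show ?thesis by simp
qed

lemma Re_scale_in_Linf_R:
  assumes "\<psi> \<in> Linf"
  shows "(\<lambda>x. complex_of_real (Re (c * \<psi> x))) \<in> Linf_R"
proof -
  obtain D where m: "\<psi> \<in> borel_measurable lebesgue" and D: "AE x in lebesgue. cmod (\<psi> x) \<le> D"
    using assms by (auto simp: Linf_iff)
  have "AE x in lebesgue. cmod (complex_of_real (Re (c * \<psi> x))) \<le> cmod c * D"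
    using D
  proof eventually_elim
    case (elim x)
    have "cmod (complex_of_real (Re (c * \<psi> x))) \<le> cmod (c * \<psi> x)"
      using abs_Re_le_cmod[of "c * \<psi> x"] by (simp only: norm_of_real)
    also have "\<dots> \<le> cmod c * D"
      using elim by (simp add: norm_mult mult_left_mono)
    finally show ?case .
  qed
  moreover have "(\<lambda>x. complex_of_real (Re (c * \<psi> x))) \<in> borel_measurable lebesgue"
    using m by measurable
  ultimately show ?thesis by (auto simp: Linf_R_def Linf_iff)
qed

text \<open>The upper functional of the real part of \<open>c * \<psi>\<close> is at most the limit
  of \<open>W\<close>, namely 0, for every unit \<open>c\<close>. Opposite choices of
  \<open>c\<close> turn this one-sided bound into vanishing, and two components recover
  \<open>\<psi>\<close>.\<close>

lemma mean_eq_0: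
  assumes f: "f \<in> P_R" and \<Phi>: "is_mean \<Phi>"
    and le: "\<And>\<phi>. \<phi> \<in> Linf_R \<Longrightarrow> ereal (Re (\<Phi> \<phi>)) \<le> upper_F f \<phi>"
    and \<psi>: "\<psi> \<in> Linf" and W0: "(W \<longlongrightarrow> 0) at_top"
    and W: "\<And>r x. r > 0 \<Longrightarrow> cmod (conv (dilate f r) \<psi> x) \<le> W r"
  shows "\<Phi> \<psi> = 0"
proof -
  have dual: "\<Phi> \<in> Linf_dual" using \<Phi> by (simp add: is_mean_def)
  define R where "R c = (\<lambda>x. complex_of_real (Re (c * \<psi> x)))" for c
  have R: "R c \<in> Linf_R" for c unfolding R_def by (rule Re_scale_in_Linf_R[OF \<psi>])
  then have RL: "R c \<in> Linf" for c by (simp add: Linf_R_def)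
  have nonpos: "Re (\<Phi> (R c)) \<le> 0" if c: "cmod c = 1" for c
  proof -
    have "upper_F f (R c) \<le> Limsup at_top (\<lambda>r. ereal (W r))"
      unfolding upper_F_def
    proof (rule Limsup_mono, rule eventually_mono[OF eventually_gt_at_top[of 0]], rule SUP_least)
      fix r x :: real
      assume r: "r > 0"
      have "integrable lebesgue (dilate f r)"
        using dilate_P_R[OF f r] by (simp add: P_R_def)
      then have "Re (conv (dilate f r) (R c) x) = Re (c * conv (dilate f r) \<psi> x)"
        unfolding R_def by (rule Re_conv_of_real_Re[OF _ \<psi>])
      also have "\<dots> \<le> cmod (conv (dilate f r) \<psi> x)"
        using complex_Re_le_cmod[of "c * conv (dilate f r) \<psi> x"] c by (simp add: norm_mult)
      also have "\<dots> \<le> W r" by (rule W[OF r])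
      finally show "ereal (Re (conv (dilate f r) (R c) x)) \<le> ereal (W r)" by simp
    qed
    also have "\<dots> = ereal 0"
      using W0 by (intro lim_imp_Limsup) auto
    finally show ?thesis using le[OF R[of c]] order_trans by fastforce
  qed
  have zero: "\<Phi> (R c) = 0" if c: "cmod c = 1" for c
  proof -
    have "R (- c) = (\<lambda>x. (- 1) * R c x)" by (auto simp: R_def)
    then have "\<Phi> (R (- c)) = (- 1) * \<Phi> (R c)"
      using Linf_dualD(2)[OF dual RL, of "-1" c] by simp
    moreover have "Re (\<Phi> (R (- c))) \<le> 0" "Re (\<Phi> (R c)) \<le> 0"
      using c by (auto intro: nonpos)
    ultimately have "Re (\<Phi> (R c)) = 0" by simp
    \<comment> \<open>Only the real part has been shown to vanish; the imaginary part is 0 because a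
      mean is real on real-valued functions.\<close>
    with is_mean_real[OF \<Phi> R[of c]] show ?thesis
      by (simp add: complex_eq_iff complex_is_Real_iff)
  qed
  have scaled: "(\<lambda>x. \<i> * R (- \<i>) x) \<in> Linf"
    by (rule Linf_scale[OF RL])
  \<comment> \<open>The real part of \<open>- \<i> * \<psi> x\<close> is the imaginary part of
    \<open>\<psi> x\<close>.\<close>
  have "\<psi> = (\<lambda>x. R 1 x + \<i> * R (- \<i>) x)"
    by (auto simp: R_def complex_eq_iff)
  then have "\<Phi> \<psi> = \<Phi> (\<lambda>x. R 1 x + \<i> * R (- \<i>) x)" by simp
  also have "\<dots> = \<Phi> (R 1) + \<i> * \<Phi> (R (- \<i>))"
    by (simp only: Linf_dualD(1)[OF dual RL scaled] Linf_dualD(2)[OF dual RL])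
  also have "\<dots> = 0" by (simp add: zero)
  finally show ?thesis .
qed

section \<open>Domination of an invariant mean by suprema of convolutions\<close>

text \<open>Positivity is applied to the constant \<open>m\<close> minus \<open>\<phi>\<close>, and
  normalisation evaluates the mean of the constant.\<close>

lemma mean_le_upper_bound:
  assumes \<Phi>: "is_mean \<Phi>" and \<phi>: "\<phi> \<in> Linf"
    and real: "\<And>x. \<phi> x \<in> \<real>" and le: "\<And>x. Re (\<phi> x) \<le> m"
  shows "Re (\<Phi> \<phi>) \<le> m"
proof -
  have dual: "\<Phi> \<in> Linf_dual" and \<Phi>1: "\<Phi> (\<lambda>x. 1) = 1"
    and pos: "\<And>\<phi>. \<phi> \<in> Linf \<Longrightarrow> AE x in lebesgue. \<phi> x \<in> \<real>\<^sub>\<ge>\<^sub>0 \<Longrightarrow> \<Phi> \<phi> \<in> \<real>\<^sub>\<ge>\<^sub>0"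
    using \<Phi> by (auto simp: is_mean_def)
  have const: "(\<lambda>x. c) \<in> Linf" for c :: complex by (auto simp: Linf_iff)
  have scaled: "(\<lambda>x. (- 1) * \<phi> x) \<in> Linf"
    by (rule Linf_scale[OF \<phi>])
  have "\<Phi> (\<lambda>x. complex_of_real m + (- 1) * \<phi> x) \<in> \<real>\<^sub>\<ge>\<^sub>0"
    using real le
    by (intro pos Linf_add_scale const \<phi> always_eventually allI)
      (auto simp: complex_nonneg_Reals_iff complex_is_Real_iff)
  also have "\<Phi> (\<lambda>x. complex_of_real m + (- 1) * \<phi> x) = \<Phi> (\<lambda>x. complex_of_real m) + (- 1) * \<Phi> \<phi>"
    by (simp only: Linf_dualD(1)[OF dual const scaled] Linf_dualD(2)[OF dual \<phi>])
  also have "\<Phi> (\<lambda>x. complex_of_real m) = complex_of_real m"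
    using Linf_dualD(2)[OF dual const[of 1], of "complex_of_real m"] \<Phi>1 by simp
  finally show ?thesis by (simp add: complex_nonneg_Reals_iff)
qed

text \<open>Although \<open>\<phi>\<close> is real only almost everywhere, \<open>conv_cong\<close>
  replaces it by its real part, which makes the convolution real at every point.\<close>

lemma conv_Linf_R_real:
  assumes f: "f \<in> borel_measurable lebesgue" and \<phi>: "\<phi> \<in> Linf_R"
  shows "conv f \<phi> x \<in> \<real>"
proof -
  have "conv f \<phi> x = conv f (\<lambda>x. complex_of_real (Re (\<phi> x))) x"
  proof (rule conv_cong)
    show m: "\<phi> \<in> borel_measurable lebesgue" using \<phi> by (simp add: Linf_R_def Linf_iff)
    show "(\<lambda>x. complex_of_real (Re (\<phi> x))) \<in> borel_measurable lebesgue" using m by measurable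
    have "AE x in lebesgue. \<phi> x \<in> \<real>" using \<phi> by (simp add: Linf_R_def)
    then show "AE x in lebesgue. \<phi> x = complex_of_real (Re (\<phi> x))"
      by eventually_elim (simp add: complex_is_Real_iff complex_eq_iff)
  qed (use f in auto)
  then show ?thesis by (simp add: conv_of_real)
qed

text \<open>Invariance replaces \<open>\<phi>\<close> by \<open>conv g \<phi>\<close>, whose
  pointwise upper bounds also bound its mean.\<close>

lemma invariant_mean_le_SUP:
  assumes inv: "topologically_invariant \<Phi>" and \<Phi>: "is_mean \<Phi>"
    and g: "g \<in> P_R" and \<phi>: "\<phi> \<in> Linf_R"
  shows "ereal (Re (\<Phi> \<phi>)) \<le> (SUP x. ereal (Re (conv g \<phi> x)))"
proof (rule ccontr)
  assume "\<not> ?thesis"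
  then have "(SUP x. ereal (Re (conv g \<phi> x))) < ereal (Re (\<Phi> \<phi>))" by simp
  \<comment> \<open>The supremum lives in the extended reals; a real \<open>m\<close> strictly
    between gives a finite bound for \<open>mean_le_upper_bound\<close>.\<close>
  then obtain m where m: "(SUP x. ereal (Re (conv g \<phi> x))) < ereal m" "m < Re (\<Phi> \<phi>)"
    by (metis ereal_dense2 ereal_less(2) less_ereal.simps(1))
  have L: "\<phi> \<in> Linf" using \<phi> by (simp add: Linf_R_def)
  have "ereal (Re (conv g \<phi> x)) < ereal m" for x
    using m(1) by (meson SUP_upper UNIV_I le_less_trans)
  then have "Re (conv g \<phi> x) \<le> m" for x
    by (simp add: less_imp_le)
  moreover have "conv g \<phi> x \<in> \<real>" for x
    by (rule conv_Linf_R_real[OF _ \<phi>]) (use g in \<open>auto simp: P_R_def\<close>)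
  ultimately have "Re (\<Phi> (conv g \<phi>)) \<le> m"
    by (intro mean_le_upper_bound[OF \<Phi> conv_in_Linf[OF g L]])
  then show False
    using m(2) inv g L by (simp add: topologically_invariant_def)
qed

text \<open>Comparing only the real part of the mean loses nothing, since by
  \<open>is_mean_real\<close> the mean is real on \<open>Linf_R\<close>.\<close>

theorem theorem3p4:
  fixes f :: "real \<Rightarrow> real" and \<Phi> :: "(real \<Rightarrow> complex) \<Rightarrow> complex"
  assumes "f \<in> P_R" and "is_mean \<Phi>"
  shows "topologically_invariant \<Phi> \<longleftrightarrow> (\<forall>\<phi>\<in>Linf_R. ereal (Re (\<Phi> \<phi>)) \<le> upper_F f \<phi>)"
proof
  assume inv: "topologically_invariant \<Phi>"
  show "\<forall>\<phi>\<in>Linf_R. ereal (Re (\<Phi> \<phi>)) \<le> upper_F f \<phi>"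
  proof
    fix \<phi> assume \<phi>: "\<phi> \<in> Linf_R"
    show "ereal (Re (\<Phi> \<phi>)) \<le> upper_F f \<phi>"
      unfolding upper_F_def
      \<comment> \<open>Every dilate with \<open>r > 0\<close> is again in \<open>P_R\<close>, so
        the supremum bound holds for all such \<open>r\<close> and passes to the upper
        limit.\<close>
      by (intro le_Limsup eventually_mono[OF eventually_gt_at_top[of 0]]
          invariant_mean_le_SUP[OF inv assms(2) _ \<phi>] dilate_P_R[OF assms(1)]) simp_all
  qed
next
  assume le: "\<forall>\<phi>\<in>Linf_R. ereal (Re (\<Phi> \<phi>)) \<le> upper_F f \<phi>"
  have dual: "\<Phi> \<in> Linf_dual" using assms(2) by (simp add: is_mean_def)
  show "topologically_invariant \<Phi>"
    unfolding topologically_invariant_def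
  proof (intro ballI)
    fix g \<phi> assume g: "g \<in> P_R" and \<phi>: "\<phi> \<in> Linf"
    obtain W where W: "(W \<longlongrightarrow> 0) at_top"
      "\<And>r x. r > 0 \<Longrightarrow> cmod (conv (dilate f r) (\<lambda>x. conv g \<phi> x + (-1) * \<phi> x) x) \<le> W r"
      using conv_dilate_diff_tendsto_0[OF assms(1) g \<phi>] by blast
    note L = conv_in_Linf[OF g \<phi>]
    have scaled: "(\<lambda>x. (- 1) * \<phi> x) \<in> Linf"
      by (rule Linf_scale[OF \<phi>])
    \<comment> \<open>By linearity, invariance amounts to vanishing on this difference, whose
      convolutions with the dilates are bounded by \<open>W\<close>.\<close>
    have "\<Phi> (\<lambda>x. conv g \<phi> x + (-1) * \<phi> x) = 0"
      using le by (intro mean_eq_0[OF assms _ Linf_add_scale[OF L \<phi>] W]) auto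
    then show "\<Phi> (conv g \<phi>) = \<Phi> \<phi>"
      by (simp only: Linf_dualD(1)[OF dual L scaled] Linf_dualD(2)[OF dual \<phi>]) simp
  qed
qed

end
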